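(* Let $m\ge1$ be an integer, $n=2m$, and let $C=a\,C_a\oplus b\,C_b$ be an $H_{32}$-code of length $2m$, with binary component $C_a\subseteq\mathbb{F}_2^{n}$ and ternary component $C_b\subseteq\mathbb{F}_3^{n}$. Then $C$ is symplectic self-dual if and only if $C_a=\mathbb{F}_2^n$ and $C_b$ is a ternary symplectic self-dual code.
   Context: Ring: $H_{32}=\langle a,b\mid 2a=0,\ 3b=0,\ a^2=0,\ b^2=b,\ ab=ba=0\rangle$ is the commutative non-unital ring of order six with elements $0,a,b,a+b,2b,a+2b$. For $\mathbf{x}\in\mathbb{F}_2^n$, $a\mathbf{x}$ is the vector obtained coordinatewise from $a\cdot0=0$, $a\cdot1=a$; for $\mathbf{y}\in\mathbb{F}_3^n$, $b\mathbf{y}$ is obtained coordinatewise from $b\cdot0=0$, $b\cdot1=b$, $b\cdot2=2b$. Every vector of $H_{32}^n$ is uniquely $a\mathbf{x}+b\mathbf{y}$ with $\mathbf{x}\in\mathbb{F}_2^n$, $\mathbf{y}\in\mathbb{F}_3^n$. Codes: an $H_{32}$-code of length $n$ is an $H_{32}$-submodule $C\subseteq H_{32}^n$ (an additive subgroup closed under multiplication by elements of $H_{32}$). It decomposes as $C=aC_a\oplus bC_b=\{a\mathbf{u}+b\mathbf{v}: \mathbf{u}\in C_a,\mathbf{v}\in C_b\}$ with $C_a=\{\mathbf{u}\in\mathbb{F}_2^n: a\mathbf{u}\in C\}$ and $C_b=\{\mathbf{v}\in\mathbb{F}_3^n: b\mathbf{v}\in C\}$, which are linear codes over $\mathbb{F}_2$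 and $\mathbb{F}_3$ respectively. Symplectic forms: for $\mathbf{x}=(\mathbf{x}_1\mid\mathbf{x}_2),\mathbf{y}=(\mathbf{y}_1\mid\mathbf{y}_2)\in\mathbb{F}_3^{2m}$ with $\mathbf{x}_i,\mathbf{y}_i\in\mathbb{F}_3^m$, set $\langle\mathbf{x},\mathbf{y}\rangle_s^{(\mathbb{F}_3)}=\mathbf{x}_1\cdot\mathbf{y}_2-\mathbf{x}_2\cdot\mathbf{y}_1$, where $\cdot$ is the usual dot product. For $\mathbf{c}=a\mathbf{x}+b\mathbf{y}$, $\mathbf{c}'=a\mathbf{x}'+b\mathbf{y}'$ in $H_{32}^{2m}$ (with $\mathbf{x},\mathbf{x}'\in\mathbb{F}_2^{2m}$, $\mathbf{y},\mathbf{y}'\in\mathbb{F}_3^{2m}$), set $\langle\mathbf{c},\mathbf{c}'\rangle_S=b\langle\mathbf{y},\mathbf{y}'\rangle_s^{(\mathbb{F}_3)}$ (the binary part contributes $0$ because $a^2=0$). The symplectic dual $C^{\perp_S}$ of a code $C$ (over $\mathbb{F}_3$ or $H_{32}$, of length $2m$) is the set of all vectors of the ambient space orthogonal to every element of $C$ under the corresponding symplectic form. $C$ is symplectic self-dual if $C=C^{\perp_S}$. *)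

theory Defs
  imports "HOL-Analysis.Analysis"
begin

section \<open>The prime fields\<close>

text \<open>The numeral types \<^typ>\<open>2\<close> and \<^typ>\<open>3\<close> carry arithmetic modulo 2 and modulo 3. The library makes
  them commutative unital rings but not instances of class \<^class>\<open>field\<close>, so linear codes are
  expressed with \<^const>\<open>module.subspace\<close> rather than with \<open>vec.subspace\<close>.\<close>

type_synonym F2 = "2"
type_synonym F3 = "3"

lemma F2_cases: "(x::F2) = 0 \<or> x = 1"
  using exhaust_2[of x] by auto

lemma F3_cases: "(x::F3) = 0 \<or> x = 1 \<or> x = 2"
  using exhaust_3[of x] by auto

section \<open>The ring of order six\<close>

text \<open>\<open>H32 i j\<close> stands for \<open>i a + j b\<close>. Class \<^class>\<open>comm_ring\<close> does not require a unit.\<close>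

datatype H32 = H32 (a_coord: F2) (b_coord: F3)

instantiation H32 :: comm_ring
begin
definition "0 = H32 0 0"
definition "x + y = H32 (a_coord x + a_coord y) (b_coord x + b_coord y)"
definition "- x = H32 (- a_coord x) (- b_coord x)"
definition "x - y = H32 (a_coord x - a_coord y) (b_coord x - b_coord y)"
definition "x * y = H32 0 (b_coord x * b_coord y)"
instance
  by standard
    (auto simp: zero_H32_def plus_H32_def uminus_H32_def minus_H32_def times_H32_def
      algebra_simps)
end

lemmas H32_arith = zero_H32_def plus_H32_def uminus_H32_def minus_H32_def times_H32_def

definition a_H :: H32 where "a_H = H32 1 0"
definition b_H :: H32 where "b_H = H32 0 1"

lemma H32_relations:
  "a_H + a_H = 0" "b_H + b_H + b_H = 0" "a_H * a_H = 0" "b_H * b_H = b_H"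
  "a_H * b_H = 0" "b_H * a_H = 0"
  by (simp_all add: a_H_def b_H_def H32_arith)

lemma H32_elements:
  "UNIV = {0, a_H, b_H, a_H + b_H, b_H + b_H, a_H + (b_H + b_H)}"
proof -
  have "x \<in> {0, a_H, b_H, a_H + b_H, b_H + b_H, a_H + (b_H + b_H)}" for x
    using F2_cases[of "a_coord x"] F3_cases[of "b_coord x"]
    by (cases x) (auto simp: a_H_def b_H_def H32_arith)
  then show ?thesis by blast
qed

lemma card_H32: "card (UNIV :: H32 set) = 6"
  unfolding H32_elements by (simp add: a_H_def b_H_def H32_arith)

text \<open>Universal property: the type is the ring presented by the relations above.\<close>

lemma H32_presentation:
  fixes \<alpha> \<beta> :: "'r::ring"
  assumes "\<alpha> + \<alpha> = 0" "\<beta> + \<beta> + \<beta> = 0" "\<alpha> * \<alpha> = 0" "\<beta> * \<beta> = \<beta>"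
    "\<alpha> * \<beta> = 0" "\<beta> * \<alpha> = 0"
  shows "\<exists>!f. (\<forall>x y. f (x + y) = f x + f y) \<and> (\<forall>x y. f (x * y) = f x * f y) \<and>
    f a_H = \<alpha> \<and> f b_H = \<beta>"
proof -
  let ?P = "\<lambda>f. (\<forall>x y. f (x + y) = f x + f y) \<and> (\<forall>x y. f (x * y) = f x * f y) \<and>
    f a_H = \<alpha> \<and> f b_H = \<beta>"
  define g where "g x = (if a_coord x = 0 then 0 else \<alpha>) +
    (if b_coord x = 0 then 0 else if b_coord x = 1 then \<beta> else \<beta> + \<beta>)" for x
  have b3: "\<beta> + (\<beta> + \<beta>) = 0" "\<And>z. \<beta> + (\<beta> + (\<beta> + z)) = z" "\<And>z. \<alpha> + (\<alpha> + z) = z"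
    using assms by (simp_all add: add.assoc[symmetric])
  have add: "g (x + y) = g x + g y" for x y
    using F2_cases[of "a_coord x"] F3_cases[of "b_coord x"]
      F2_cases[of "a_coord y"] F3_cases[of "b_coord y"]
    by (elim disjE) (simp_all add: g_def plus_H32_def b3 assms(1) ac_simps)
  have mult: "g (x * y) = g x * g y" for x y
    using F2_cases[of "a_coord x"] F3_cases[of "b_coord x"]
      F2_cases[of "a_coord y"] F3_cases[of "b_coord y"]
    by (elim disjE) (simp_all add: g_def times_H32_def b3 assms(3-) algebra_simps)
  have P: "?P g" using add mult by (simp add: g_def a_H_def b_H_def)
  have "f = g" if f: "?P f" for f
  proof
    fix x
    have f0: "f 0 = 0" using f by (metis add_cancel_right_right)
    have g0: "g 0 = 0" by (simp add: g_def zero_H32_def)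
    have "x \<in> {0, a_H, b_H, a_H + b_H, b_H + b_H, a_H + (b_H + b_H)}"
      using H32_elements by blast
    then show "f x = g x" using f P f0 g0 by auto
  qed
  then show ?thesis using P by blast
qed

section \<open>Vectors\<close>

definition a_smult :: "F2 \<Rightarrow> H32" where
  "a_smult i = (if i = 0 then 0 else a_H)"

definition b_smult :: "F3 \<Rightarrow> H32" where
  "b_smult j = (if j = 0 then 0 else if j = 1 then b_H else b_H + b_H)"

definition a_vec :: "F2 ^ 'n \<Rightarrow> H32 ^ 'n" where
  "a_vec x = (\<chi> i. a_smult (x $ i))"

definition b_vec :: "F3 ^ 'n \<Rightarrow> H32 ^ 'n" where
  "b_vec y = (\<chi> i. b_smult (y $ i))"

definition ternary_coords :: "H32 ^ 'n \<Rightarrow> F3 ^ 'n" where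
  "ternary_coords c = (\<chi> i. b_coord (c $ i))"

lemma a_smult_eq: "a_smult i = H32 i 0"
  using F2_cases[of i] by (auto simp: a_smult_def a_H_def zero_H32_def)

lemma b_smult_eq: "b_smult j = H32 0 j"
  using F3_cases[of j] by (auto simp: b_smult_def b_H_def zero_H32_def plus_H32_def)

lemma ternary_coords_decomp: "ternary_coords (a_vec x + b_vec y) = y"
  by (simp add: ternary_coords_def a_vec_def b_vec_def a_smult_eq b_smult_eq plus_H32_def
      vec_eq_iff)

lemma vector_decomp: "\<exists>!(x, y). c = a_vec x + b_vec y"
  for c :: "H32 ^ 'n"
proof (rule ex1I[of _ "((\<chi> i. a_coord (c $ i)), ternary_coords c)"])
  show "case ((\<chi> i. a_coord (c $ i)), ternary_coords c) of (x, y) \<Rightarrow> c = a_vec x + b_vec y"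
    by (simp add: ternary_coords_def a_vec_def b_vec_def a_smult_eq b_smult_eq plus_H32_def
        vec_eq_iff)
qed (auto simp: ternary_coords_def a_vec_def b_vec_def a_smult_eq b_smult_eq plus_H32_def
        vec_eq_iff)

section \<open>Codes\<close>

text \<open>\<^term>\<open>r *s c\<close> is the coordinatewise product of the vector \<^term>\<open>c\<close> with the scalar
  \<^term>\<open>r\<close>. As the ring has no unit, this is not an instance of the library's modules.\<close>

definition H32_code :: "(H32 ^ 'n) set \<Rightarrow> bool" where
  "H32_code C \<longleftrightarrow> 0 \<in> C \<and> (\<forall>c\<in>C. \<forall>d\<in>C. c + d \<in> C) \<and> (\<forall>c\<in>C. - c \<in> C) \<and>
    (\<forall>r. \<forall>c\<in>C. r *s c \<in> C)"

definition linear_code :: "('a::comm_ring_1 ^ 'n) set \<Rightarrow> bool" where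
  "linear_code D \<longleftrightarrow> module.subspace (*s) D"

definition binary_part :: "(H32 ^ 'n) set \<Rightarrow> (F2 ^ 'n) set" where
  "binary_part C = {u. a_vec u \<in> C}"

definition ternary_part :: "(H32 ^ 'n) set \<Rightarrow> (F3 ^ 'n) set" where
  "ternary_part C = {v. b_vec v \<in> C}"

lemma module_vec: "module ((*s) :: 'a::comm_ring_1 \<Rightarrow> 'a ^ 'n \<Rightarrow> 'a ^ 'n)"
  by standard (auto simp: vec_eq_iff algebra_simps)

lemma linear_code_iff:
  "linear_code D \<longleftrightarrow> 0 \<in> D \<and> (\<forall>x\<in>D. \<forall>y\<in>D. x + y \<in> D) \<and> (\<forall>r. \<forall>x\<in>D. r *s x \<in> D)"
  unfolding linear_code_def by (auto simp: module.subspace_def[OF module_vec])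

lemma a_vec_add: "a_vec (x + y) = a_vec x + a_vec y"
  by (simp add: a_vec_def a_smult_eq plus_H32_def vec_eq_iff)

lemma b_vec_add: "b_vec (x + y) = b_vec x + b_vec y"
  by (simp add: b_vec_def b_smult_eq plus_H32_def vec_eq_iff)

lemma b_vec_smult: "b_vec (r *s y) = H32 0 r *s b_vec y"
  by (simp add: b_vec_def b_smult_eq times_H32_def vec_eq_iff)

lemma a_vec_0: "a_vec 0 = 0" and b_vec_0: "b_vec 0 = 0"
  by (simp_all add: a_vec_def b_vec_def a_smult_def b_smult_def vec_eq_iff)

lemma linear_binary_part:
  assumes C: "H32_code C"
  shows "linear_code (binary_part C)"
proof -
  have "a_vec (r *s x) \<in> C" if "a_vec x \<in> C" for r x
    using F2_cases[of r] that C
    by (auto simp: H32_code_def a_vec_0 vector_smult_lid vector_smult_lzero)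
  then show ?thesis
    using C by (auto simp: linear_code_iff binary_part_def H32_code_def a_vec_add a_vec_0)
qed

lemma linear_ternary_part: "H32_code C \<Longrightarrow> linear_code (ternary_part C)"
  unfolding H32_code_def linear_code_iff ternary_part_def
  by (auto simp: b_vec_add b_vec_0 b_vec_smult)

lemma H32_code_decomp:
  fixes C :: "(H32 ^ 'n) set"
  assumes C: "H32_code C"
  shows "C = {a_vec u + b_vec v | u v. u \<in> binary_part C \<and> v \<in> ternary_part C}"
proof -
  have "u \<in> binary_part C \<and> v \<in> ternary_part C" if m: "a_vec u + b_vec v \<in> C" for u v
  proof -
    have "b_H *s (a_vec u + b_vec v) = b_vec v"
      by (simp add: a_vec_def b_vec_def a_smult_eq b_smult_eq b_H_def plus_H32_def
          times_H32_def vec_eq_iff)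
    then have v: "b_vec v \<in> C" using C m unfolding H32_code_def by metis
    then have "(a_vec u + b_vec v) + - b_vec v \<in> C" using C m unfolding H32_code_def by blast
    then show ?thesis using v by (simp add: binary_part_def ternary_part_def)
  qed
  moreover have "a_vec u + b_vec v \<in> C" if "u \<in> binary_part C" "v \<in> ternary_part C" for u v
    using C that by (auto simp: H32_code_def binary_part_def ternary_part_def)
  moreover have "\<exists>u v. c = a_vec u + b_vec v" for c :: "H32 ^ 'n"
    using vector_decomp[of c] by auto
  ultimately show ?thesis by (intro set_eqI iffI) (force, blast)
qed

section \<open>Symplectic forms and duals\<close>

text \<open>Vectors of length \<open>2m\<close> are indexed by \<^typ>\<open>'m + 'm\<close> with \<open>m = CARD('m)\<close>: the halves of
  \<open>x = (x\<^sub>1 | x\<^sub>2)\<close> are the coordinates at \<^const>\<open>Inl\<close> and at \<^const>\<open>Inr\<close>.\<close>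

definition left_half :: "'a ^ ('m::finite + 'm) \<Rightarrow> 'a ^ 'm" where
  "left_half x = (\<chi> i. x $ Inl i)"

definition right_half :: "'a ^ ('m::finite + 'm) \<Rightarrow> 'a ^ 'm" where
  "right_half x = (\<chi> i. x $ Inr i)"

definition dot_F3 :: "F3 ^ 'm \<Rightarrow> F3 ^ 'm \<Rightarrow> F3" where
  "dot_F3 x y = (\<Sum>i\<in>UNIV. x $ i * y $ i)"

definition sympl_F3 :: "F3 ^ ('m::finite + 'm) \<Rightarrow> F3 ^ ('m + 'm) \<Rightarrow> F3" where
  "sympl_F3 x y = dot_F3 (left_half x) (right_half y) - dot_F3 (right_half x) (left_half y)"

definition sympl_H32 :: "H32 ^ ('m::finite + 'm) \<Rightarrow> H32 ^ ('m + 'm) \<Rightarrow> H32" where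
  "sympl_H32 c d = b_smult (sympl_F3 (ternary_coords c) (ternary_coords d))"

lemma sympl_H32_decomp:
  "sympl_H32 (a_vec x + b_vec y) (a_vec x' + b_vec y') = b_smult (sympl_F3 y y')"
  by (simp add: sympl_H32_def ternary_coords_decomp)

definition sympl_dual_F3 :: "(F3 ^ ('m::finite + 'm)) set \<Rightarrow> (F3 ^ ('m + 'm)) set" where
  "sympl_dual_F3 D = {x. \<forall>y\<in>D. sympl_F3 x y = 0}"

definition sympl_dual_H32 :: "(H32 ^ ('m::finite + 'm)) set \<Rightarrow> (H32 ^ ('m + 'm)) set" where
  "sympl_dual_H32 C = {c. \<forall>d\<in>C. sympl_H32 c d = 0}"

definition sympl_self_dual_F3 :: "(F3 ^ ('m::finite + 'm)) set \<Rightarrow> bool" where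
  "sympl_self_dual_F3 D \<longleftrightarrow> D = sympl_dual_F3 D"

definition sympl_self_dual_H32 :: "(H32 ^ ('m::finite + 'm)) set \<Rightarrow> bool" where
  "sympl_self_dual_H32 C \<longleftrightarrow> C = sympl_dual_H32 C"

end

theory Submission
  imports Defs
begin

text \<open>The symplectic form on \<open>H32\<close> sees only ternary coordinates, so the dual of
  C consists of all a u + b v with u arbitrary and v in the ternary dual of C_b
  (\<open>sympl_dual_H32_mem_iff\<close>). Since C is itself the direct sum of its two parts
  (\<open>H32_code_mem_iff\<close>), C equals its dual exactly when the components agree: C_a is the
  whole space and C_b is its own dual.\<close>

lemma ex_vector_decomp: "\<exists>u v. c = a_vec u + b_vec v"
  for c :: "H32 ^ 'n"
  using vector_decomp[of c] by auto

lemma vector_decomp_eq_iff: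
  "a_vec u + b_vec v = a_vec u' + b_vec v' \<longleftrightarrow> u = u' \<and> v = v'"
  by (auto simp: a_vec_def b_vec_def a_smult_eq b_smult_eq plus_H32_def vec_eq_iff)

lemma H32_set_eq_iff:
  "C = D \<longleftrightarrow> (\<forall>u v. a_vec u + b_vec v \<in> C \<longleftrightarrow> a_vec u + b_vec v \<in> D)"
  for C D :: "(H32 ^ 'n) set"
  by (metis ex_vector_decomp set_eqI)

lemma H32_code_mem_iff:
  assumes "H32_code C"
  shows "a_vec u + b_vec v \<in> C \<longleftrightarrow> u \<in> binary_part C \<and> v \<in> ternary_part C"
  by (subst H32_code_decomp[OF assms]) (auto simp: vector_decomp_eq_iff)

lemma b_smult_eq_0_iff: "b_smult j = 0 \<longleftrightarrow> j = 0"
  by (simp add: b_smult_eq zero_H32_def)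

text \<open>The binary coordinates u are unconstrained because they never enter the form.\<close>

lemma sympl_dual_H32_mem_iff:
  assumes C: "H32_code C"
  shows "a_vec u + b_vec v \<in> sympl_dual_H32 C \<longleftrightarrow> v \<in> sympl_dual_F3 (ternary_part C)"
proof -
  \<comment> \<open>A binary part exists to pair with each v' in \<open>ternary_part C\<close>, so
    the quantifier over u' below is not vacuous.\<close>
  have "0 \<in> binary_part C"
    using linear_binary_part[OF C] by (simp add: linear_code_iff)
  have "a_vec u + b_vec v \<in> sympl_dual_H32 C \<longleftrightarrow>
      (\<forall>u'\<in>binary_part C. \<forall>v'\<in>ternary_part C.
        sympl_H32 (a_vec u + b_vec v) (a_vec u' + b_vec v') = 0)"
    unfolding sympl_dual_H32_def by (subst H32_code_decomp[OF C]) blast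
  with \<open>0 \<in> binary_part C\<close> show ?thesis
    unfolding sympl_dual_F3_def by (auto simp: sympl_H32_decomp b_smult_eq_0_iff)
qed

lemma zero_in_sympl_dual_F3: "0 \<in> sympl_dual_F3 D"
  by (simp add: sympl_dual_F3_def sympl_F3_def dot_F3_def left_half_def right_half_def)

theorem theorem4p11:
  fixes C :: "(H32 ^ ('m::finite + 'm)) set"
  assumes "H32_code C"
  shows "sympl_self_dual_H32 C \<longleftrightarrow>
    binary_part C = UNIV \<and>
    linear_code (ternary_part C) \<and> sympl_self_dual_F3 (ternary_part C)"
proof -
  have "sympl_self_dual_H32 C \<longleftrightarrow>
      (\<forall>u v. u \<in> binary_part C \<and> v \<in> ternary_part C \<longleftrightarrow> v \<in> sympl_dual_F3 (ternary_part C))"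
    unfolding sympl_self_dual_H32_def H32_set_eq_iff[of C]
    by (simp add: H32_code_mem_iff[OF assms] sympl_dual_H32_mem_iff[OF assms])
  \<comment> \<open>Taking v = 0, which always lies in the dual, forces every u into
    \<open>binary_part C\<close>; the condition on u then disappears and equality of the ternary
    sets remains.\<close>
  also have "\<dots> \<longleftrightarrow> binary_part C = UNIV \<and> sympl_self_dual_F3 (ternary_part C)"
    unfolding sympl_self_dual_F3_def using zero_in_sympl_dual_F3[of "ternary_part C"] by blast
  finally show ?thesis using linear_ternary_part[OF assms] by blast
qed

end
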